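(* Let $R$ be a commutative ring with identity such that $2\in R^\times$, let $C\in\operatorname{Mat}_2(R)$ be cyclic, let $F\in\operatorname{GL}_2(R)$, let $K_1,\dots,K_m\in\operatorname{Orb}(C)$, and put $G_i=FK_i$ for $i=1,\dots,m$. (1) The family $K_1,\dots,K_m$ is affinely saturated if and only if $$\mathfrak D_3(G_2-G_1,\ldots,G_m-G_1)=R.$$ (2) If $\operatorname{tr}(C)=0$, the family $K_1,\dots,K_m$ is linearly saturated if and only if $$\mathfrak D_3(G_1,\ldots,G_m)=R.$$
   Context: A matrix $C\in\operatorname{Mat}_2(R)$ is cyclic if there exists $v\in R^2$ such that $(v,Cv)$ is an $R$-basis of $R^2$. $\operatorname{Orb}(C)=\{PCP^{-1}:P\in\operatorname{GL}_2(R)\}$ and $\mathfrak{sl}_2(R)=\{X\in\operatorname{Mat}_2(R):\operatorname{tr}(X)=0\}$. For $X_1,\ldots,X_r\in\operatorname{Mat}_2(R)$, choose any $R$-basis of $\operatorname{Mat}_2(R)$ and let $M(X_1,\ldots,X_r)\in\operatorname{Mat}_{4\times r}(R)$ be the matrix whose $j$th column is the coordinate vector of $X_j$. Then $\mathfrak D_3(X_1,\ldots,X_r)\subseteq R$ is the ideal generated by the $3\times 3$ minors of $M(X_1,\ldots,X_r)$ (independent of the basis). A family $K_1,\dots,K_m\in\operatorname{Orb}(C)$ is affinely saturated if $\operatorname{span}_R\{K_i-K_1:i=2,\ldots,m\}=\mathfrak{sl}_2(R)$. If $\operatorname{tr}(C)=0$, it is linearly saturated if $\operatorname{span}_R\{K_1,\ldots,K_m\}=\mathfrak{sl}_2(R)$.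 *)

theory Defs
  imports "HOL-Analysis.Analysis"
begin

text \<open>
  On \<open>'a^'n^'m\<close> the library's \<open>(*s)\<close> takes its scalars from \<open>'a^'n\<close>, so the \<open>'a\<close>-module
  structure on matrices is introduced separately.
\<close>

definition mat_scale :: "'a::comm_ring_1 \<Rightarrow> 'a^'n^'m \<Rightarrow> 'a^'n^'m"
  where "mat_scale c A = (\<chi> i j. c * A $ i $ j)"

lemma module_mat_scale: "module (mat_scale :: 'a::comm_ring_1 \<Rightarrow> 'a^'n^'m \<Rightarrow> 'a^'n^'m)"
  by standard (simp_all add: mat_scale_def vec_eq_iff algebra_simps)

lemma module_vec_scale: "module ((*s) :: 'a::comm_ring_1 \<Rightarrow> 'a^'n \<Rightarrow> 'a^'n)"
  by standard (simp_all add: vec_eq_iff algebra_simps)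

lemma module_ring_scale: "module ((*) :: 'a::comm_ring_1 \<Rightarrow> 'a \<Rightarrow> 'a)"
  by standard (simp_all add: algebra_simps)

definition module_basis :: "('a::comm_ring_1 \<Rightarrow> 'b::ab_group_add \<Rightarrow> 'b) \<Rightarrow> 'b set \<Rightarrow> bool"
  where "module_basis smul B \<longleftrightarrow> \<not> module.dependent smul B \<and> module.span smul B = UNIV"

text \<open>
  \<^const>\<open>module_basis\<close> is about sets; for a family of vectors to be a basis its members must also be
  pairwise distinct, whence the condition \<open>v \<noteq> C *v v\<close>.
\<close>

definition cyclic_matrix :: "'a::comm_ring_1^2^2 \<Rightarrow> bool"
  where "cyclic_matrix C \<longleftrightarrow> (\<exists>v. v \<noteq> C *v v \<and> module_basis (*s) {v, C *v v})"

definition conj_orbit :: "'a::comm_ring_1^2^2 \<Rightarrow> ('a^2^2) set"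
  where "conj_orbit C = {P ** C ** matrix_inv P | P. invertible P}"

definition sl2 :: "('a::comm_ring_1^2^2) set"
  where "sl2 = {X. trace X = 0}"

definition matrix_basis :: "(4 \<Rightarrow> 'a::comm_ring_1^2^2) \<Rightarrow> bool"
  where "matrix_basis b \<longleftrightarrow> inj b \<and> module_basis mat_scale (range b)"

text \<open>
  Entry \<open>(i, j)\<close> of the matrix whose \<open>j\<close>th column is the coordinate vector of \<open>X j\<close> in the basis
  \<open>b\<close>.  The columns are indexed by natural numbers, so that the number of columns can vary.
\<close>

definition coord_matrix ::
    "(4 \<Rightarrow> 'a::comm_ring_1^2^2) \<Rightarrow> (nat \<Rightarrow> 'a^2^2) \<Rightarrow> 4 \<Rightarrow> nat \<Rightarrow> 'a"
  where "coord_matrix b X i j = module.representation mat_scale (range b) (X j) (b i)"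

text \<open>
  A \<open>3 \<times> 3\<close> minor is given by increasing enumerations of its three rows and of its three columns;
  the columns are taken from \<open>J\<close>.
\<close>

definition minors3 :: "nat set \<Rightarrow> (4 \<Rightarrow> nat \<Rightarrow> 'a::comm_ring_1) \<Rightarrow> 'a set"
  where "minors3 J M =
    {det ((\<chi> k l. M (p k) (q l)) :: 'a^3^3) | (p :: 3 \<Rightarrow> 4) (q :: 3 \<Rightarrow> nat).
      strict_mono p \<and> strict_mono q \<and> range q \<subseteq> J}"

text \<open>
  \<open>det_ideal3 b J X\<close> is the third determinantal ideal of the family \<open>(X j)\<close>, \<open>j \<in> J\<close>, computed in
  the basis \<open>b\<close>.  The ideal generated by a set is its span in the ring as a module over itself.
\<close>

definition det_ideal3 ::
    "(4 \<Rightarrow> 'a::comm_ring_1^2^2) \<Rightarrow> nat set \<Rightarrow> (nat \<Rightarrow> 'a^2^2) \<Rightarrow> 'a set"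
  where "det_ideal3 b J X = module.span (*) (minors3 J (coord_matrix b X))"

definition affinely_saturated :: "nat \<Rightarrow> (nat \<Rightarrow> 'a::comm_ring_1^2^2) \<Rightarrow> bool"
  where "affinely_saturated m K \<longleftrightarrow>
    module.span mat_scale ((\<lambda>i. K i - K 1) ` {2..m}) = sl2"

definition linearly_saturated :: "nat \<Rightarrow> (nat \<Rightarrow> 'a::comm_ring_1^2^2) \<Rightarrow> bool"
  where "linearly_saturated m K \<longleftrightarrow> module.span mat_scale (K ` {1..m}) = sl2"

end

theory Submission
  imports Defs
begin

text \<open>
  Conjugation preserves the trace, so both parts are instances of one claim: for a family \<open>Y\<close> of
  trace-zero matrices and \<open>X j = F ** Y j\<close>, the \<open>Y j\<close> span \<open>sl2\<close> iff the third determinantal ideal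
  of the \<open>X j\<close> is the unit ideal (\<open>span_eq_sl2_iff_det_ideal3\<close>).

  The module \<open>sl2\<close> is free of rank 3, and it is a direct summand of the module of all matrices.
  Write \<open>w j\<close> for the coordinate vector of \<open>Y j\<close> in \<open>R^3\<close>.  The map that sends such a vector to the
  coordinates, with respect to \<open>b\<close>, of \<open>F\<close> times the corresponding matrix is given by a \<open>4 \<times> 3\<close>
  matrix with rows \<open>L i\<close>, and it has a left inverse because \<open>F\<close> is invertible and \<open>sl2\<close> is a
  summand.  The \<open>(i, j)\<close> entry of the coordinate matrix is the scalar product of \<open>L i\<close> and \<open>w j\<close>,
  so each \<open>3 \<times> 3\<close> minor is a minor of \<open>L\<close> times a minor of \<open>w\<close> (\<open>minors3_factor\<close>).  What remains
  are two facts on the ideal of \<open>3 \<times> 3\<close> minors of a family of vectors in \<open>R^3\<close>.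

  \<^item> If the family spans \<open>R^3\<close>, this ideal contains 1: the standard basis, whose determinant is 1, is
    a combination of members of the family, and the determinant is multilinear and alternating
    (\<open>one_in_row_minors_ideal\<close>).  This applies to \<open>L\<close> because of its left inverse, and to \<open>w\<close>
    when \<open>Y\<close> spans \<open>sl2\<close>; the ideal of products then contains 1 as well.

  \<^item> Each such minor multiplies \<open>R^3\<close> into the span of the family, by Cramer's rule
    (\<open>row_minor_scales_into_span\<close>).  Hence so does every element of the determinantal ideal, and if
    that ideal contains 1, the family \<open>w\<close> spans \<open>R^3\<close>.
\<close>

section \<open>Maximal minors of families of vectors of length three\<close>

interpretation mat_mod: module mat_scale by (rule module_mat_scale)
interpretation vec_mod: module "(*s)" by (rule module_vec_scale)
interpretation ideal: module "(*)" by (rule module_ring_scale)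

(* For ring multiplication this simplification rule reads a * (b * x) = a * b * x, which loops
   together with the associativity rule in algebra_simps. *)
declare ideal.scale_scale [simp del]

text \<open>
  The numeral 3 denotes 0 in the index type \<open>3\<close>, so the indices are ordered as \<open>3 < 1 < 2\<close>.
\<close>

lemma strict_mono_3_iff:
  fixes q :: "3 \<Rightarrow> 'i::linorder"
  shows "strict_mono q \<longleftrightarrow> q 3 < q 1 \<and> q 1 < q 2"
proof -
  have order_3: "(3::3) < 1" "(1::3) < 2" "(3::3) < 2"
    "\<not> (1::3) < 3" "\<not> (2::3) < 1" "\<not> (2::3) < 3"
    by (simp_all add: less_bit1_def bit1.Rep_numeral bit1.Rep_1)
  show ?thesis
    unfolding strict_mono_def forall_3 using order_3 by (auto intro: less_trans)
qed

text \<open>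
  The members of the family are the rows of the minors, and only increasing choices of rows are
  admitted, to match \<^const>\<open>minors3\<close>.
\<close>

definition row_minors :: "'i::linorder set \<Rightarrow> ('i \<Rightarrow> 'a::comm_ring_1^3) \<Rightarrow> 'a set"
  where "row_minors S w =
    {det (\<chi> k. w (q k)) | q :: 3 \<Rightarrow> 'i. strict_mono q \<and> range q \<subseteq> S}"

text \<open>
  The determinant is alternating: an unsorted choice of rows changes a minor at most by a sign, and a
  repeated row makes it vanish.
\<close>

lemma det_selected_rows_in_ideal:
  fixes w :: "'i::linorder \<Rightarrow> 'a::comm_ring_1^3"
  assumes "{x, y, z} \<subseteq> S"
  shows "det (vector [w x, w y, w z]) \<in> ideal.span (row_minors S w)"
proof -
  let ?I = "ideal.span (row_minors S w)"
  let ?D = "\<lambda>x y z. det (vector [w x, w y, w z])"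
  (* Since 3 is the least index, the smallest row x stands at index 3, the last place. *)
  have incr: "?D y z x \<in> ?I" if "x < y" "y < z" "{x, y, z} \<subseteq> S" for x y z
  proof -
    define q :: "3 \<Rightarrow> 'i" where "q k = (if k = 3 then x else if k = 1 then y else z)" for k
    have "strict_mono q" "range q \<subseteq> S"
      using that by (auto simp: strict_mono_3_iff q_def)
    moreover have "(\<chi> k. w (q k)) = vector [w y, w z, w x]"
      by (simp add: vec_eq_iff[where 'b=3] forall_3 q_def)
    ultimately have "?D y z x \<in> row_minors S w"
      unfolding row_minors_def by (auto intro!: exI[of _ q])
    then show ?thesis
      by (rule ideal.span_base)
  qed
  have rotate: "?D x y z = ?D y z x" and flip: "?D x y z = - ?D y x z"
    and repeated: "?D x x z = 0" for x y z
    by (simp_all add: det_3)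
  have sorted: "?D x y z \<in> ?I" if "x < y" "y < z" "{x, y, z} \<subseteq> S" for x y z
    using incr[OF that] rotate by metis
  have two_sorted: "?D x y z \<in> ?I" if "x < y" "{x, y, z} \<subseteq> S" for x y z
  proof -
    consider "y < z" | "z < x" | "x < z" "z < y" | "z = x" | "z = y"
      by fastforce
    then show ?thesis
    proof cases
      case 3
      have "?D x y z = - ?D x z y"
        by (metis rotate flip)
      with 3 sorted[of x z y] that show ?thesis
        by (simp add: ideal.span_neg)
    next
      case 4
      have "?D x y z = 0" using 4 rotate repeated by metis
      then show ?thesis by (simp add: ideal.span_zero)
    next
      case 5
      have "?D x y z = 0" using 5 rotate repeated by metis
      then show ?thesis by (simp add: ideal.span_zero)
    next
      case 1 then show ?thesis using sorted[of x y z] that by simp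
    next
      case 2
      then show ?thesis using sorted[of z x y] that rotate[of z x y] by auto
    qed
  qed
  consider "x < y" | "y < x" | "x = y"
    by fastforce
  then show ?thesis
  proof cases
    case 1 then show ?thesis using two_sorted assms by blast
  next
    case 2
    then have "?D y x z \<in> ?I" using two_sorted[of y x z] assms by auto
    then show ?thesis using flip[of x y z] by (simp add: ideal.span_neg)
  next
    case 3
    then show ?thesis using repeated by (simp add: ideal.span_zero)
  qed
qed

text \<open>
  Multilinearity lets each row in turn be replaced by members of the family.  Only the first row
  is treated directly; a cyclic rotation, which is an even permutation, brings the other rows there.
\<close>

lemma det_rows_in_span:
  fixes w :: "'i::linorder \<Rightarrow> 'a::comm_ring_1^3"
  assumes "u1 \<in> vec_mod.span (w ` S)" "u2 \<in> vec_mod.span (w ` S)" "u3 \<in> vec_mod.span (w ` S)"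
  shows "det (vector [u1, u2, u3]) \<in> ideal.span (row_minors S w)"
proof -
  let ?I = "ideal.span (row_minors S w)"
  let ?D = "\<lambda>x y z. det (vector [x, y, z] :: 'a^3^3)"
  have zero: "?D 0 y z = 0"
    and add: "?D (c *s x + x') y z = c * ?D x y z + ?D x' y z" for c x x' y z
    by (simp_all add: det_3 algebra_simps)
  have first: "?D u y z \<in> ?I"
    if "u \<in> vec_mod.span (w ` S)" and "\<And>x. x \<in> w ` S \<Longrightarrow> ?D x y z \<in> ?I" for u y z
    using that(1)
    by (induction rule: vec_mod.span_induct_alt)
      (auto simp: zero add ideal.span_zero that(2) intro!: ideal.span_add ideal.span_scale)
  have rotate: "?D x y z = ?D y z x" for x y z
    by (simp add: det_3)
  have "?D x y z \<in> ?I" if "x \<in> w ` S" "y \<in> w ` S" "z \<in> w ` S" for x y z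
    using that by (auto intro!: det_selected_rows_in_ideal)
  then have "?D u1 y z \<in> ?I" if "y \<in> w ` S" "z \<in> w ` S" for y z
    using that first[OF assms(1)] by blast
  then have "?D u2 z u1 \<in> ?I" if "z \<in> w ` S" for z
    using that first[OF assms(2)] rotate by metis
  then have "?D u3 u1 u2 \<in> ?I"
    using first[OF assms(3)] rotate by metis
  then show ?thesis
    using rotate by metis
qed

lemma one_in_row_minors_ideal:
  fixes w :: "'i::linorder \<Rightarrow> 'a::comm_ring_1^3"
  assumes "vec_mod.span (w ` S) = UNIV"
  shows "1 \<in> ideal.span (row_minors S w)"
proof -
  have "det (vector [vector [1, 0, 0], vector [0, 1, 0], vector [0, 0, 1]] :: 'a^3^3) = 1"
    by (simp add: det_3)
  then show ?thesis
    using det_rows_in_span[where w = w and S = S] assms by (metis UNIV_I)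
qed

lemma cramer_rule_3:
  fixes a b c x :: "'a::comm_ring_1^3"
  shows "det (vector [a, b, c]) *s x =
    det (vector [x, b, c]) *s a + det (vector [a, x, c]) *s b + det (vector [a, b, x]) *s c"
  by (simp add: det_3 vec_eq_iff forall_3 algebra_simps)

text \<open>
  This is how a unit among the minors, or merely 1 in the ideal that they generate, forces the family
  to span: by Cramer's rule without division, \<open>d *s x\<close> is a combination of the three rows that
  give the minor \<open>d\<close>.
\<close>

lemma row_minor_scales_into_span:
  fixes w :: "'i::linorder \<Rightarrow> 'a::comm_ring_1^3"
  assumes "d \<in> row_minors S w"
  shows "d *s x \<in> vec_mod.span (w ` S)"
proof -
  obtain q :: "3 \<Rightarrow> 'i" where d: "d = det (\<chi> k. w (q k))" and q: "range q \<subseteq> S"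
    using assms unfolding row_minors_def by auto
  let ?D = "\<lambda>x y z. det (vector [x, y, z] :: 'a^3^3)"
  let ?u = "w (q 1)" and ?v = "w (q 2)" and ?z = "w (q 3)"
  have rows: "(\<chi> k. w (q k)) = vector [?u, ?v, ?z]"
    by (simp add: vec_eq_iff[where 'b = 3] forall_3)
  have x: "d *s x = ?D x ?v ?z *s ?u + ?D ?u x ?z *s ?v + ?D ?u ?v x *s ?z"
    unfolding d rows by (rule cramer_rule_3)
  have "w (q k) \<in> vec_mod.span (w ` S)" for k
    using q by (intro vec_mod.span_base) auto
  then show ?thesis
    unfolding x by (intro vec_mod.span_add vec_mod.span_scale)
qed

text \<open>
  If \<open>M\<close> factors through \<open>R^3\<close>, each of its \<open>3 \<times> 3\<close> submatrices is a product of two \<open>3 \<times> 3\<close>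
  matrices, one formed from rows of \<open>L\<close> and one from the vectors \<open>w j\<close> as columns.
\<close>

lemma minors3_factor:
  fixes L :: "4 \<Rightarrow> 'a::comm_ring_1^3" and w :: "nat \<Rightarrow> 'a^3"
  assumes M: "\<And>i j. j \<in> J \<Longrightarrow> M i j = (\<Sum>k\<in>UNIV. L i $ k * w j $ k)"
  shows "minors3 J M = {c * d | c d. c \<in> row_minors UNIV L \<and> d \<in> row_minors J w}"
proof -
  have det: "det ((\<chi> k l. M (p k) (q l)) :: 'a^3^3) = det (\<chi> k. L (p k)) * det (\<chi> l. w (q l))"
    if "range q \<subseteq> J" for p :: "3 \<Rightarrow> 4" and q :: "3 \<Rightarrow> nat"
  proof -
    have "(\<chi> k l. M (p k) (q l)) = (\<chi> k. L (p k)) ** transpose (\<chi> l. w (q l))"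
      using that M by (auto simp: vec_eq_iff matrix_matrix_mult_def transpose_def image_subset_iff)
    then show ?thesis
      by (simp add: det_mul)
  qed
  show ?thesis
  proof (intro equalityI subsetI)
    fix x assume "x \<in> minors3 J M"
    then obtain p :: "3 \<Rightarrow> 4" and q :: "3 \<Rightarrow> nat"
      where p: "strict_mono p" and q: "strict_mono q" "range q \<subseteq> J"
        and x: "x = det ((\<chi> k l. M (p k) (q l)) :: 'a^3^3)"
      unfolding minors3_def by auto
    have "det (\<chi> k. L (p k)) \<in> row_minors UNIV L" "det (\<chi> l. w (q l)) \<in> row_minors J w"
      unfolding row_minors_def using p q by blast+
    then show "x \<in> {c * d | c d. c \<in> row_minors UNIV L \<and> d \<in> row_minors J w}"
      unfolding x det[OF q(2)] by blast
  next
    fix x assume "x \<in> {c * d | c d. c \<in> row_minors UNIV L \<and> d \<in> row_minors J w}"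
    then obtain p :: "3 \<Rightarrow> 4" and q :: "3 \<Rightarrow> nat"
      where p: "strict_mono p" and q: "strict_mono q" "range q \<subseteq> J"
        and x: "x = det (\<chi> k. L (p k)) * det (\<chi> l. w (q l))"
      unfolding row_minors_def by auto
    show "x \<in> minors3 J M"
      unfolding minors3_def x det[OF q(2), symmetric] using p q by blast
  qed
qed

text \<open>
  The ideal generated by the products contains
  \<open>a * d\<close> for each \<open>a\<close> in the first ideal and each \<open>d\<close> in \<open>B\<close>; for \<open>a = 1\<close> this gives all of \<open>B\<close>,
  hence 1.
\<close>

lemma one_in_ideal_prod:
  fixes A B :: "'a::comm_ring_1 set"
  assumes A: "1 \<in> ideal.span A" and B: "1 \<in> ideal.span B"
  shows "1 \<in> ideal.span {c * d | c d. c \<in> A \<and> d \<in> B}" (is "1 \<in> ?I")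
proof -
  have "a * d \<in> ?I" if "a \<in> ideal.span A" "d \<in> B" for a d
    using that(1)
  proof (induction rule: ideal.span_induct_alt)
    case (step c x y)
    have "x * d \<in> ?I" using step that by (auto intro!: ideal.span_base)
    then have "c * (x * d) + y * d \<in> ?I"
      using step.IH by (rule ideal.span_add[OF ideal.span_scale])
    then show ?case by (simp add: algebra_simps)
  qed (simp add: ideal.span_zero)
  then have "B \<subseteq> ?I" using A by force
  then show ?thesis using B ideal.span_minimal[OF _ ideal.subspace_span] by blast
qed

lemma ideal_eq_UNIV_iff: "ideal.span A = UNIV \<longleftrightarrow> (1::'a::comm_ring_1) \<in> ideal.span A"
  using ideal.span_scale[of 1 A] by auto

section \<open>Trace-zero matrices as a free summand of rank three\<close>

text \<open>
  Defined on all matrices, this is the coordinate isomorphism of \<open>sl2\<close> and at the same time the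
  projection that makes \<open>sl2\<close> a direct summand.
\<close>

definition sl2_coords :: "'a::comm_ring_1^2^2 \<Rightarrow> 'a^3"
  where "sl2_coords X = vector [X $ 1 $ 1, X $ 1 $ 2, X $ 2 $ 1]"

definition sl2_matrix :: "'a::comm_ring_1^3 \<Rightarrow> 'a^2^2"
  where "sl2_matrix x = vector [vector [x $ 1, x $ 2], vector [x $ 3, - x $ 1]]"

lemma sl2_coords_sl2_matrix: "sl2_coords (sl2_matrix x) = x"
  by (simp add: sl2_coords_def sl2_matrix_def vec_eq_iff forall_3)

lemma sl2_matrix_in_sl2: "sl2_matrix x \<in> sl2"
  by (simp add: sl2_def sl2_matrix_def trace_def sum_2)

lemma sl2_matrix_sl2_coords: "X \<in> sl2 \<Longrightarrow> sl2_matrix (sl2_coords X) = X"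
  by (simp add: sl2_coords_def sl2_matrix_def vec_eq_iff forall_2 sl2_def trace_def sum_2 add_eq_0_iff)

lemma sl2_coords_hom: "module_hom mat_scale (*s) sl2_coords"
  by unfold_locales (simp_all add: sl2_coords_def mat_scale_def vec_eq_iff forall_3)

lemma sl2_matrix_hom: "module_hom (*s) mat_scale sl2_matrix"
  by unfold_locales (simp_all add: sl2_matrix_def mat_scale_def vec_eq_iff forall_2)

lemma matrix_mult_hom: "module_hom mat_scale mat_scale (\<lambda>X. (F :: 'a::comm_ring_1^2^2) ** X)"
  by unfold_locales
    (simp_all add: matrix_matrix_mult_def mat_scale_def vec_eq_iff forall_2 sum_2 algebra_simps)

lemma span_eq_sl2_iff:
  assumes "Y ` J \<subseteq> sl2"
  shows "mat_mod.span (Y ` J) = sl2 \<longleftrightarrow> vec_mod.span ((sl2_coords \<circ> Y) ` J) = UNIV"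
proof -
  interpret c: module_hom mat_scale "(*s)" "sl2_coords :: 'a^2^2 \<Rightarrow> 'a^3" by (rule sl2_coords_hom)
  interpret e: module_hom "(*s)" mat_scale "sl2_matrix :: 'a^3 \<Rightarrow> 'a^2^2" by (rule sl2_matrix_hom)
  have 1: "vec_mod.span ((sl2_coords \<circ> Y) ` J) = sl2_coords ` mat_mod.span (Y ` J)"
    unfolding image_comp[symmetric] by (rule c.span_image)
  have "sl2_matrix ` (sl2_coords \<circ> Y) ` J = Y ` J"
    using assms by (force simp: image_image sl2_matrix_sl2_coords image_subset_iff)
  then have 2: "mat_mod.span (Y ` J) = sl2_matrix ` vec_mod.span ((sl2_coords \<circ> Y) ` J)"
    using e.span_image[of "(sl2_coords \<circ> Y) ` J"] by simp
  have "sl2_coords ` sl2 = UNIV"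
    using sl2_coords_sl2_matrix sl2_matrix_in_sl2 by (metis UNIV_eq_I image_eqI)
  moreover have "range sl2_matrix = sl2"
    using sl2_matrix_sl2_coords sl2_matrix_in_sl2 by (metis image_subsetI rangeI subsetI subset_antisym)
  ultimately show ?thesis
    using 1 2 by metis
qed

section \<open>Spanning and the determinantal ideal\<close>

text \<open>
  Here \<open>L i\<close> represents the linear form that maps \<open>x\<close> to the \<open>i\<close>th coordinate of
  \<open>F ** sl2_matrix x\<close>.  The map \<open>L\<close> from \<open>R^3\<close> to \<open>R^4\<close> has a left inverse: form the matrix with the
  given coordinates, multiply by the inverse of \<open>F\<close>, and project to \<open>sl2\<close>.  Read by rows instead of
  columns, the equation for this left inverse says that the rows of \<open>L\<close> span \<open>R^3\<close>.
\<close>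

lemma coord_linear_forms:
  fixes F :: "'a::comm_ring_1^2^2"
  assumes "matrix_basis b" and "invertible F"
  obtains L :: "4 \<Rightarrow> 'a^3"
  where "\<And>Z i. Z \<in> sl2 \<Longrightarrow>
      mat_mod.representation (range b) (F ** Z) (b i) = (\<Sum>k\<in>UNIV. L i $ k * sl2_coords Z $ k)"
    and "vec_mod.span (range L) = UNIV"
proof -
  interpret F: module_hom mat_scale mat_scale "\<lambda>X. F ** X" by (rule matrix_mult_hom)
  obtain F' where F': "F' ** F = mat 1"
    using assms(2) unfolding invertible_def by auto
  interpret F': module_hom mat_scale mat_scale "\<lambda>X. F' ** X" by (rule matrix_mult_hom)
  interpret c: module_hom mat_scale "(*s)" "sl2_coords :: 'a^2^2 \<Rightarrow> 'a^3" by (rule sl2_coords_hom)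
  interpret e: module_hom "(*s)" mat_scale "sl2_matrix :: 'a^3 \<Rightarrow> 'a^2^2" by (rule sl2_matrix_hom)
  have inj: "inj b" and indep: "\<not> mat_mod.dependent (range b)"
    and spans: "mat_mod.span (range b) = UNIV"
    using assms(1) by (auto simp: matrix_basis_def module_basis_def)
  define \<phi> where "\<phi> i X = mat_mod.representation (range b) X (b i)" for i X
  have \<phi>_add: "\<phi> i (X + Y) = \<phi> i X + \<phi> i Y"
    and \<phi>_scale: "\<phi> i (mat_scale r X) = r * \<phi> i X" for i X Y r
    by (simp_all add: \<phi>_def mat_mod.representation_add mat_mod.representation_scale indep spans)
  have expand: "X = (\<Sum>i\<in>UNIV. mat_scale (\<phi> i X) (b i))" for X
    using mat_mod.sum_representation_eq[OF indep, of X "range b"]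
    by (simp add: spans \<phi>_def sum.reindex[OF inj])
  define L :: "4 \<Rightarrow> 'a^3" where "L i = (\<chi> k. \<phi> i (F ** sl2_matrix (axis k 1)))" for i
  have basis_3: "x = (\<Sum>k\<in>UNIV. x $ k *s axis k 1)" for x :: "'a^3"
    by (simp add: vec_eq_iff axis_def sum_3 forall_3)
  have \<phi>_F: "\<phi> i (F ** sl2_matrix x) = (\<Sum>k\<in>UNIV. L i $ k * x $ k)" for i x
    by (subst basis_3[of x])
      (simp add: sum_3 e.add e.scale F.add F.scale \<phi>_add \<phi>_scale L_def mult.commute)
  show thesis
  proof
    fix Z :: "'a^2^2" and i
    assume "Z \<in> sl2"
    then have "mat_mod.representation (range b) (F ** Z) (b i) = \<phi> i (F ** sl2_matrix (sl2_coords Z))"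
      by (simp add: \<phi>_def sl2_matrix_sl2_coords)
    then show "mat_mod.representation (range b) (F ** Z) (b i) = (\<Sum>k\<in>UNIV. L i $ k * sl2_coords Z $ k)"
      by (simp add: \<phi>_F)
  next
    have left_inverse: "x = (\<Sum>i\<in>UNIV. (\<Sum>k\<in>UNIV. L i $ k * x $ k) *s sl2_coords (F' ** b i))" for x
    proof -
      have "x = sl2_coords (F' ** (F ** sl2_matrix x))"
        by (simp add: matrix_mul_assoc F' sl2_coords_sl2_matrix)
      also have "F ** sl2_matrix x = (\<Sum>i\<in>UNIV. mat_scale (\<phi> i (F ** sl2_matrix x)) (b i))"
        by (rule expand)
      finally show ?thesis
        by (simp add: F'.sum F'.scale c.sum c.scale \<phi>_F)
    qed
    have "y = (\<Sum>i\<in>UNIV. (\<Sum>k\<in>UNIV. y $ k * sl2_coords (F' ** b i) $ k) *s L i)" for y :: "'a^3"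
    proof -
      (* The entries of the product of the left inverse and L, which is the identity matrix. *)
      have delta: "(\<Sum>i\<in>UNIV. L i $ l * sl2_coords (F' ** b i) $ k) = (if k = l then 1 else 0)" for k l
      proof -
        have "(axis l 1 :: 'a^3) $ k = (\<Sum>i\<in>UNIV. L i $ l * sl2_coords (F' ** b i) $ k)"
          by (subst left_inverse[of "axis l 1"]) (simp add: axis_def if_distrib cong: if_cong)
        then show ?thesis by (simp add: axis_def)
      qed
      have "(\<Sum>i\<in>UNIV. (\<Sum>k\<in>UNIV. y $ k * sl2_coords (F' ** b i) $ k) * L i $ l) = y $ l" for l
      proof -
        have "(\<Sum>i\<in>UNIV. (\<Sum>k\<in>UNIV. y $ k * sl2_coords (F' ** b i) $ k) * L i $ l)
            = (\<Sum>k\<in>UNIV. y $ k * (\<Sum>i\<in>UNIV. L i $ l * sl2_coords (F' ** b i) $ k))"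
          unfolding sum_distrib_left sum_distrib_right by (subst sum.swap) (simp add: mult_ac)
        then show ?thesis by (simp add: delta if_distrib cong: if_cong)
      qed
      then show ?thesis by (simp add: vec_eq_iff)
    qed
    then have "y \<in> vec_mod.span (range L)" for y
      by (metis (no_types, lifting) rangeI vec_mod.span_base vec_mod.span_scale vec_mod.span_sum)
    then show "vec_mod.span (range L) = UNIV" by auto
  qed
qed

text \<open>
  Let \<open>w j\<close> be the coordinates of \<open>Y j\<close>, and \<open>L\<close> the linear forms from \<open>coord_linear_forms\<close>.  The
  minors of \<open>L\<close> always generate the unit ideal.  If \<open>Y\<close> spans \<open>sl2\<close>, those of \<open>w\<close> do so too, hence
  also the products.  Conversely, each generator of the determinantal ideal is a multiple of a minor
  of \<open>w\<close>, so it multiplies \<open>R^3\<close> into the span of \<open>w\<close>; this property passes to the whole ideal, and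
  for the element 1 it says that \<open>w\<close> spans \<open>R^3\<close>.
\<close>

lemma span_eq_sl2_iff_det_ideal3:
  fixes F :: "'a::comm_ring_1^2^2"
  assumes "matrix_basis b" and "invertible F"
    and sl2: "\<And>j. j \<in> J \<Longrightarrow> Y j \<in> sl2" and X: "\<And>j. j \<in> J \<Longrightarrow> X j = F ** Y j"
  shows "mat_mod.span (Y ` J) = sl2 \<longleftrightarrow> det_ideal3 b J X = UNIV"
proof -
  define w where "w = sl2_coords \<circ> Y"
  obtain L :: "4 \<Rightarrow> 'a^3"
    where L: "\<And>Z i. Z \<in> sl2 \<Longrightarrow>
        mat_mod.representation (range b) (F ** Z) (b i) = (\<Sum>k\<in>UNIV. L i $ k * sl2_coords Z $ k)"
      and span_L: "vec_mod.span (range L) = UNIV"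
    using coord_linear_forms[OF assms(1,2)] by blast
  have minors: "minors3 J (coord_matrix b X)
      = {c * d | c d. c \<in> row_minors UNIV L \<and> d \<in> row_minors J w}"
  proof (rule minors3_factor)
    fix i j assume "j \<in> J"
    then show "coord_matrix b X i j = (\<Sum>k\<in>UNIV. L i $ k * w j $ k)"
      by (simp add: w_def coord_matrix_def L X sl2)
  qed
  have "vec_mod.span (w ` J) = UNIV \<longleftrightarrow> 1 \<in> ideal.span (minors3 J (coord_matrix b X))"
  proof
    assume "vec_mod.span (w ` J) = UNIV"
    then show "1 \<in> ideal.span (minors3 J (coord_matrix b X))"
      unfolding minors by (intro one_in_ideal_prod one_in_row_minors_ideal span_L)
  next
    assume one: "1 \<in> ideal.span (minors3 J (coord_matrix b X))"
    have "r *s x \<in> vec_mod.span (w ` J)"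
      if "r \<in> ideal.span (minors3 J (coord_matrix b X))" for r x
      using that
    proof (induction rule: ideal.span_induct_alt)
      case (step a r s)
      then obtain c d where r: "r = c * d" and d: "d \<in> row_minors J w"
        unfolding minors by auto
      have "(a * c) *s (d *s x) + s *s x \<in> vec_mod.span (w ` J)"
        by (rule vec_mod.span_add[OF vec_mod.span_scale[OF row_minor_scales_into_span[OF d]] step.IH])
      then show ?case
        by (simp add: r vec_mod.scale_left_distrib mult.assoc)
    qed (simp add: vec_mod.span_zero)
    from this[OF one] show "vec_mod.span (w ` J) = UNIV" by auto
  qed
  then show ?thesis
    unfolding det_ideal3_def ideal_eq_UNIV_iff w_def using span_eq_sl2_iff[of Y J] sl2 by auto
qed

lemma trace_conj_orbit: "X \<in> conj_orbit C \<Longrightarrow> trace X = trace C"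
proof -
  assume "X \<in> conj_orbit C"
  then obtain P where X: "X = P ** C ** matrix_inv P" and P: "invertible P"
    unfolding conj_orbit_def by auto
  have "matrix_inv P ** P = mat 1"
    using P unfolding invertible_def matrix_inv_def by (rule someI2_ex) simp
  then show ?thesis
    unfolding X by (subst trace_mul_sym) (simp add: matrix_mul_assoc)
qed

theorem proposition3p6:
  fixes C F :: "'a::comm_ring_1^2^2"
    and K G :: "nat \<Rightarrow> 'a^2^2"
    and m :: nat
    and b :: "4 \<Rightarrow> 'a^2^2"
  assumes "(2::'a) dvd 1"
    and "cyclic_matrix C"
    and "invertible F"
    and "m \<ge> 1"
    and "\<And>i. i \<in> {1..m} \<Longrightarrow> K i \<in> conj_orbit C"
    and "\<And>i. i \<in> {1..m} \<Longrightarrow> G i = F ** K i"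
    and "matrix_basis b"
  shows "(affinely_saturated m K \<longleftrightarrow> det_ideal3 b {2..m} (\<lambda>i. G i - G 1) = UNIV) \<and>
    (trace C = 0 \<longrightarrow> (linearly_saturated m K \<longleftrightarrow> det_ideal3 b {1..m} G = UNIV))"
proof (intro conjI impI)
  interpret F: module_hom mat_scale mat_scale "\<lambda>X. F ** X" by (rule matrix_mult_hom)
  have trace_K: "trace (K i) = trace C" if "i \<in> {1..m}" for i
    using assms(5)[OF that] by (rule trace_conj_orbit)
  show "affinely_saturated m K \<longleftrightarrow> det_ideal3 b {2..m} (\<lambda>i. G i - G 1) = UNIV"
    unfolding affinely_saturated_def
  proof (rule span_eq_sl2_iff_det_ideal3[OF assms(7,3)])
    fix i assume "i \<in> {2..m}"
    then have i: "i \<in> {1..m}" "1 \<in> {1..m}" by auto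
    show "K i - K 1 \<in> sl2"
      using trace_K[OF i(1)] trace_K[OF i(2)] by (simp add: sl2_def trace_sub)
    show "G i - G 1 = F ** (K i - K 1)"
      by (simp only: assms(6)[OF i(1)] assms(6)[OF i(2)] F.diff)
  qed
  show "linearly_saturated m K \<longleftrightarrow> det_ideal3 b {1..m} G = UNIV" if "trace C = 0"
    unfolding linearly_saturated_def
  proof (rule span_eq_sl2_iff_det_ideal3[OF assms(7,3)])
    fix i assume i: "i \<in> {1..m}"
    show "K i \<in> sl2"
      using trace_K[OF i] that by (simp add: sl2_def)
    show "G i = F ** K i"
      using i by (rule assms(6))
  qed
qed

end
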